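(* The category $\mathbf{Meas}^{\mathcal{G}}$ of Giry algebras (Eilenberg–Moore algebras over the Giry monad on the category of measurable spaces) is not equivalent to the category $\mathbf{Cvx}$ of convex spaces and affine maps.
   Context: Giry monad. $\mathbf{Meas}$ is the category of measurable spaces and measurable maps; $\mathbb{I}=[0,1]$ is the unit interval with its Borel $\sigma$-algebra. For a measurable space $X$ with $\sigma$-algebra $\Sigma X$, $\mathcal{G}(X)$ is the set of all probability measures on $X$, with the $\sigma$-algebra induced by (i.e. the smallest making measurable) the evaluations $ev_K:\mathcal{G}(X)\to\mathbb{I}$, $ev_K(\varphi)=\varphi(K)$, $K\in\Sigma X$. For measurable $f:X\to Y$, $\mathcal{G}(f)(\varphi)=\varphi\circ f^{-1}$ is the pushforward. The unit $\eta_X:X\to\mathcal{G}(X)$ sends each point to its Dirac measure, and the multiplication $\mu_X:\mathcal{G}^2(X)\to\mathcal{G}(X)$ is $\mu_X(\varphi)(K)=\int_{\xi\in\mathcal{G}(X)}\xi(K)\,d\varphi$ for $K\in\Sigma X$. Giry algebras. A Giry algebra is an Eilenberg–Moore algebra over $(\mathcal{G},\eta,\mu)$: a pair $(X,\kappa)$ with $X$ a measurable space and $\kappa:\mathcal{G}(X)\to X$ measurable such that $\kappa\circ\eta_X=\mathrm{id}_X$ and $\kappa\circ\mathcal{G}(\kappa)=\kappa\circ\mu_X$. A morphism $(X,\kappa)\to(Y,\lambda)$ is a measurable map $f:X\to Y$ with $f\circ\kappa=\lambda\circ\mathcal{G}(f)$. The category of Giry algebras is $\mathbf{Meas}^{\mathcal{G}}$.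 Convex spaces. A convex space is a (possibly empty) set $A$ with binary operations $+_r:A\times A\to A$, $r\in[0,1]$, satisfying: $x+_0y=x$; $x+_rx=x$; $x+_ry=y+_{1-r}x$; and $(x+_ry)+_sz=x+_t(y+_{s/t}z)$ whenever $s>0$, where $t=r+s-rs$. A map $f$ of convex spaces is affine if $f(x+_ry)=f(x)+_rf(y)$ for all $x,y$ and $r\in[0,1]$. $\mathbf{Cvx}$ is the category of convex spaces with affine maps as morphisms. *)

theory Defs
  imports "HOL-Probability.Giry_Monad"
begin

section \<open>Categories, functors, equivalence\<close>

text \<open>
  Hom-sets need not be disjoint, so identities, composition and the morphism part of a
  functor take the objects involved as arguments; \<open>Cmp C X Y Z g f\<close> is
  the composite of \<open>f : X \<rightarrow> Y\<close> and \<open>g : Y \<rightarrow> Z\<close>.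
\<close>

record ('o, 'm) cat =
  Obj :: "'o set"
  Hom :: "'o \<Rightarrow> 'o \<Rightarrow> 'm set"
  Idn :: "'o \<Rightarrow> 'm"
  Cmp :: "'o \<Rightarrow> 'o \<Rightarrow> 'o \<Rightarrow> 'm \<Rightarrow> 'm \<Rightarrow> 'm"

definition category :: "('o, 'm) cat \<Rightarrow> bool" where
  "category C \<longleftrightarrow>
     (\<forall>X\<in>Obj C. Idn C X \<in> Hom C X X) \<and>
     (\<forall>X\<in>Obj C. \<forall>Y\<in>Obj C. \<forall>Z\<in>Obj C. \<forall>f\<in>Hom C X Y. \<forall>g\<in>Hom C Y Z.
        Cmp C X Y Z g f \<in> Hom C X Z) \<and>
     (\<forall>X\<in>Obj C. \<forall>Y\<in>Obj C. \<forall>f\<in>Hom C X Y.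
        Cmp C X X Y f (Idn C X) = f \<and> Cmp C X Y Y (Idn C Y) f = f) \<and>
     (\<forall>W\<in>Obj C. \<forall>X\<in>Obj C. \<forall>Y\<in>Obj C. \<forall>Z\<in>Obj C.
        \<forall>f\<in>Hom C W X. \<forall>g\<in>Hom C X Y. \<forall>h\<in>Hom C Y Z.
          Cmp C W Y Z h (Cmp C W X Y g f) = Cmp C W X Z (Cmp C X Y Z h g) f)"

record ('o, 'm, 'p, 'n) cfunctor =
  FObj :: "'o \<Rightarrow> 'p"
  FMor :: "'o \<Rightarrow> 'o \<Rightarrow> 'm \<Rightarrow> 'n"

definition is_functor ::
    "('o, 'm) cat \<Rightarrow> ('p, 'n) cat \<Rightarrow> ('o, 'm, 'p, 'n) cfunctor \<Rightarrow> bool" where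
  "is_functor C D F \<longleftrightarrow>
     (\<forall>X\<in>Obj C. FObj F X \<in> Obj D) \<and>
     (\<forall>X\<in>Obj C. \<forall>Y\<in>Obj C. \<forall>f\<in>Hom C X Y. FMor F X Y f \<in> Hom D (FObj F X) (FObj F Y)) \<and>
     (\<forall>X\<in>Obj C. FMor F X X (Idn C X) = Idn D (FObj F X)) \<and>
     (\<forall>X\<in>Obj C. \<forall>Y\<in>Obj C. \<forall>Z\<in>Obj C. \<forall>f\<in>Hom C X Y. \<forall>g\<in>Hom C Y Z.
        FMor F X Z (Cmp C X Y Z g f) =
        Cmp D (FObj F X) (FObj F Y) (FObj F Z) (FMor F Y Z g) (FMor F X Y f))"

definition id_functor :: "('o, 'm, 'o, 'm) cfunctor" where
  "id_functor = \<lparr>FObj = (\<lambda>X. X), FMor = (\<lambda>X Y f. f)\<rparr>"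

definition comp_functor ::
    "('p, 'n, 'q, 'l) cfunctor \<Rightarrow> ('o, 'm, 'p, 'n) cfunctor \<Rightarrow> ('o, 'm, 'q, 'l) cfunctor" where
  "comp_functor G F =
     \<lparr>FObj = (\<lambda>X. FObj G (FObj F X)),
      FMor = (\<lambda>X Y f. FMor G (FObj F X) (FObj F Y) (FMor F X Y f))\<rparr>"

definition is_iso :: "('o, 'm) cat \<Rightarrow> 'o \<Rightarrow> 'o \<Rightarrow> 'm \<Rightarrow> bool" where
  "is_iso C X Y f \<longleftrightarrow>
     f \<in> Hom C X Y \<and>
     (\<exists>g\<in>Hom C Y X. Cmp C X Y X g f = Idn C X \<and> Cmp C Y X Y f g = Idn C Y)"

definition naturally_isomorphic ::
    "('o, 'm) cat \<Rightarrow> ('p, 'n) cat \<Rightarrow>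
     ('o, 'm, 'p, 'n) cfunctor \<Rightarrow> ('o, 'm, 'p, 'n) cfunctor \<Rightarrow> bool" where
  "naturally_isomorphic C D F G \<longleftrightarrow>
     (\<exists>\<alpha>.
       (\<forall>X\<in>Obj C. is_iso D (FObj F X) (FObj G X) (\<alpha> X)) \<and>
       (\<forall>X\<in>Obj C. \<forall>Y\<in>Obj C. \<forall>f\<in>Hom C X Y.
          Cmp D (FObj F X) (FObj F Y) (FObj G Y) (\<alpha> Y) (FMor F X Y f) =
          Cmp D (FObj F X) (FObj G X) (FObj G Y) (FMor G X Y f) (\<alpha> X)))"

definition equivalent_categories :: "('o, 'm) cat \<Rightarrow> ('p, 'n) cat \<Rightarrow> bool" where
  "equivalent_categories C D \<longleftrightarrow>
     (\<exists>F G. is_functor C D F \<and> is_functor D C G \<and>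
        naturally_isomorphic C C (comp_functor G F) id_functor \<and>
        naturally_isomorphic D D (comp_functor F G) id_functor)"


section \<open>Size\<close>

text \<open>
  HOL has no type of all sets, so ``the category of all spaces'' is taken relative to a
  collection \<open>U\<close> of admissible underlying sets, over an arbitrary type.  The only
  requirements are that \<open>U\<close> is closed under subsets and has a member that contains a
  copy of the real line. Examples are the collection of all subsets of a type at least as large as
  \<^typ>\<open>real\<close>, and the sets of cardinality below an inaccessible cardinal in a type that
  large, which models the small sets of a Grothendieck universe.
\<close>

definition carrier_universe :: "'a set set \<Rightarrow> bool" where
  "carrier_universe U \<longleftrightarrow>
     (\<forall>A\<in>U. \<forall>B. B \<subseteq> A \<longrightarrow> B \<in> U) \<and>
     (\<exists>e :: real \<Rightarrow> 'a. inj e \<and> range e \<in> U)"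


section \<open>Giry algebras\<close>

text \<open>
  The space of probability measures is \<^const>\<open>prob_algebra\<close>, the unit is
  \<^const>\<open>return\<close>, and the pushforward of \<open>\<phi>\<close> along \<open>f : X \<rightarrow> Y\<close> is
  \<open>distr \<phi> Y f\<close>.  Binding with the identity is the multiplication: see the lemma
  \<open>emeasure_giry_mult\<close>.
\<close>

definition giry_mult :: "'a measure measure \<Rightarrow> 'a measure" where
  "giry_mult \<Phi> = \<Phi> \<bind> (\<lambda>\<xi>. \<xi>)"

lemma emeasure_giry_mult:
  assumes "\<Phi> \<in> space (prob_algebra (prob_algebra X))" "K \<in> sets X"
  shows "emeasure (giry_mult \<Phi>) K = (\<integral>\<^sup>+\<xi>. emeasure \<xi> K \<partial>\<Phi>)"
  unfolding giry_mult_def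
  by (rule emeasure_bind_prob_algebra[OF assms(1) measurable_ident_sets[OF refl] assms(2)])

lemma giry_mult_in_prob_algebra:
  assumes "\<Phi> \<in> space (prob_algebra (prob_algebra X))"
  shows "giry_mult \<Phi> \<in> space (prob_algebra X)"
  using sets_bind'[OF assms measurable_ident_sets[OF refl]]
    prob_space_bind'[OF assms measurable_ident_sets[OF refl]]
  by (simp add: giry_mult_def space_prob_algebra)

text \<open>
  A value of type \<^typ>\<open>'a measure\<close> also carries a measure; the equation
  \<open>X = sigma (space X) (sets X)\<close> makes it the zero measure, so that \<open>X\<close> is
  just a measurable space.  All functions are kept extensional, so that equality of
  morphisms is equality on the domain.
\<close>

definition giry_algebra :: "'a measure \<times> ('a measure \<Rightarrow> 'a) \<Rightarrow> bool" where
  "giry_algebra A \<longleftrightarrow> (case A of (X, \<kappa>) \<Rightarrow>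
     X = sigma (space X) (sets X) \<and>
     \<kappa> \<in> prob_algebra X \<rightarrow>\<^sub>M X \<and>
     \<kappa> \<in> extensional (space (prob_algebra X)) \<and>
     (\<forall>x\<in>space X. \<kappa> (return X x) = x) \<and>
     (\<forall>\<Phi>\<in>space (prob_algebra (prob_algebra X)). \<kappa> (distr \<Phi> X \<kappa>) = \<kappa> (giry_mult \<Phi>)))"

definition giry_hom ::
    "'a measure \<times> ('a measure \<Rightarrow> 'a) \<Rightarrow> 'a measure \<times> ('a measure \<Rightarrow> 'a) \<Rightarrow> ('a \<Rightarrow> 'a) set" where
  "giry_hom A B = (case (A, B) of ((X, \<kappa>), (Y, \<nu>)) \<Rightarrow>
     {f \<in> extensional (space X). f \<in> X \<rightarrow>\<^sub>M Y \<and>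
        (\<forall>\<phi>\<in>space (prob_algebra X). f (\<kappa> \<phi>) = \<nu> (distr \<phi> Y f))})"

definition Giry_Alg ::
    "'a set set \<Rightarrow> ('a measure \<times> ('a measure \<Rightarrow> 'a), 'a \<Rightarrow> 'a) cat" where
  "Giry_Alg U =
     \<lparr>Obj = {A. giry_algebra A \<and> space (fst A) \<in> U},
      Hom = giry_hom,
      Idn = (\<lambda>A. \<lambda>x\<in>space (fst A). x),
      Cmp = (\<lambda>A B C g f. compose (space (fst A)) g f)\<rparr>"


section \<open>Convex spaces\<close>

text \<open>
  In the pair \<open>(A, p)\<close> the term \<open>p r x y\<close> stands for \<open>x +\<^sub>r y\<close>;
  outside the unit interval and the carrier \<open>A\<close>, which may be empty, \<open>p\<close> has
  the value \<^const>\<open>undefined\<close>.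
\<close>

definition convex_space :: "'a set \<times> (real \<Rightarrow> 'a \<Rightarrow> 'a \<Rightarrow> 'a) \<Rightarrow> bool" where
  "convex_space S \<longleftrightarrow> (case S of (A, p) \<Rightarrow>
     (\<forall>r\<in>{0..1}. \<forall>x\<in>A. \<forall>y\<in>A. p r x y \<in> A) \<and>
     (\<forall>r x y. \<not> (r \<in> {0..1} \<and> x \<in> A \<and> y \<in> A) \<longrightarrow> p r x y = undefined) \<and>
     (\<forall>x\<in>A. \<forall>y\<in>A. p 0 x y = x) \<and>
     (\<forall>r\<in>{0..1}. \<forall>x\<in>A. p r x x = x) \<and>
     (\<forall>r\<in>{0..1}. \<forall>x\<in>A. \<forall>y\<in>A. p r x y = p (1 - r) y x) \<and>
     (\<forall>r\<in>{0..1}. \<forall>s\<in>{0<..1}. \<forall>x\<in>A. \<forall>y\<in>A. \<forall>z\<in>A.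
        let t = r + s - r * s in p s (p r x y) z = p t x (p (s / t) y z)))"

definition affine_hom ::
    "'a set \<times> (real \<Rightarrow> 'a \<Rightarrow> 'a \<Rightarrow> 'a) \<Rightarrow> 'a set \<times> (real \<Rightarrow> 'a \<Rightarrow> 'a \<Rightarrow> 'a) \<Rightarrow> ('a \<Rightarrow> 'a) set" where
  "affine_hom S T = (case (S, T) of ((A, p), (B, q)) \<Rightarrow>
     {f \<in> A \<rightarrow>\<^sub>E B. \<forall>r\<in>{0..1}. \<forall>x\<in>A. \<forall>y\<in>A. f (p r x y) = q r (f x) (f y)})"

definition Cvx ::
    "'a set set \<Rightarrow> ('a set \<times> (real \<Rightarrow> 'a \<Rightarrow> 'a \<Rightarrow> 'a), 'a \<Rightarrow> 'a) cat" where
  "Cvx U =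
     \<lparr>Obj = {S. convex_space S \<and> fst S \<in> U},
      Hom = affine_hom,
      Idn = (\<lambda>S. \<lambda>x\<in>fst S. x),
      Cmp = (\<lambda>S T V g f. compose (fst S) g f)\<rparr>"


section \<open>Both are categories\<close>

lemma compose_apply: "x \<in> A \<Longrightarrow> compose A g f x = g (f x)"
  by (simp add: compose_def)

lemma affine_homD:
  assumes "f \<in> affine_hom S T"
  shows "f \<in> extensional (fst S)" "\<And>x. x \<in> fst S \<Longrightarrow> f x \<in> fst T"
    "\<And>r x y. r \<in> {0..1} \<Longrightarrow> x \<in> fst S \<Longrightarrow> y \<in> fst S \<Longrightarrow>
       f (snd S r x y) = snd T r (f x) (f y)"
  using assms by (auto simp: affine_hom_def PiE_def split: prod.splits)

lemma affine_homI:
  assumes "f \<in> extensional (fst S)" "\<And>x. x \<in> fst S \<Longrightarrow> f x \<in> fst T"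
    "\<And>r x y. r \<in> {0..1} \<Longrightarrow> x \<in> fst S \<Longrightarrow> y \<in> fst S \<Longrightarrow>
       f (snd S r x y) = snd T r (f x) (f y)"
  shows "f \<in> affine_hom S T"
  using assms by (auto simp: affine_hom_def PiE_def split: prod.splits)

lemma convex_space_closed:
  assumes "convex_space S" "r \<in> {0..1}" "x \<in> fst S" "y \<in> fst S"
  shows "snd S r x y \<in> fst S"
proof -
  obtain A p where S: "S = (A, p)" by (cases S)
  have "\<forall>r\<in>{0..1}. \<forall>x\<in>A. \<forall>y\<in>A. p r x y \<in> A"
    using assms(1) unfolding S convex_space_def prod.case by (elim conjE)
  then show ?thesis using assms(2-4) unfolding S fst_conv snd_conv by blast
qed

lemma affine_hom_id:
  assumes "convex_space S"
  shows "(\<lambda>x\<in>fst S. x) \<in> affine_hom S S"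
  by (rule affine_homI) (simp_all add: convex_space_closed[OF assms])

lemma affine_hom_compose:
  assumes "convex_space S" and f: "f \<in> affine_hom S T" and g: "g \<in> affine_hom T V"
  shows "compose (fst S) g f \<in> affine_hom S V"
  by (rule affine_homI)
    (simp_all add: compose_extensional compose_apply convex_space_closed[OF assms(1)]
      affine_homD(2,3)[OF f] affine_homD(2,3)[OF g])

lemma category_Cvx: "category (Cvx U)"
  unfolding category_def
proof (intro conjI ballI)
  fix S assume "S \<in> Obj (Cvx U)"
  then show "Idn (Cvx U) S \<in> Hom (Cvx U) S S"
    by (simp add: Cvx_def affine_hom_id)
next
  fix S T V f g
  assume "S \<in> Obj (Cvx U)" "f \<in> Hom (Cvx U) S T" "g \<in> Hom (Cvx U) T V"
  then show "Cmp (Cvx U) S T V g f \<in> Hom (Cvx U) S V"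
    by (simp add: Cvx_def affine_hom_compose)
next
  fix S T f assume "f \<in> Hom (Cvx U) S T"
  then have "f \<in> affine_hom S T" by (simp add: Cvx_def)
  note D = affine_homD(1,2)[OF this]
  show "Cmp (Cvx U) S S T f (Idn (Cvx U) S) = f"
    using D(1) by (auto simp: Cvx_def compose_def extensional_def fun_eq_iff)
  show "Cmp (Cvx U) S T T (Idn (Cvx U) T) f = f"
    using D by (auto simp: Cvx_def compose_def extensional_def fun_eq_iff)
next
  fix S T V W f g h
  assume "f \<in> Hom (Cvx U) S T"
  then have f: "f \<in> affine_hom S T" by (simp add: Cvx_def)
  show "Cmp (Cvx U) S V W h (Cmp (Cvx U) S T V g f) =
      Cmp (Cvx U) S T W (Cmp (Cvx U) T V W h g) f"
    using affine_homD(2)[OF f] by (auto simp: Cvx_def compose_def fun_eq_iff)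
qed

lemma distr_restrict_id:
  assumes "\<phi> \<in> space (prob_algebra X)"
  shows "distr \<phi> X (\<lambda>x\<in>space X. x) = \<phi>"
proof -
  have s: "sets \<phi> = sets X" using assms by (simp add: space_prob_algebra)
  have "distr \<phi> X (\<lambda>x\<in>space X. x) = distr \<phi> \<phi> (\<lambda>x. x)"
    by (rule distr_cong) (auto simp: s sets_eq_imp_space_eq[OF s])
  then show ?thesis by simp
qed

lemma distr_compose:
  assumes "\<phi> \<in> space (prob_algebra X)" "f \<in> X \<rightarrow>\<^sub>M Y" "g \<in> Y \<rightarrow>\<^sub>M Z"
  shows "distr \<phi> Z (compose (space X) g f) = distr (distr \<phi> Y f) Z g"
proof -
  have s: "sets \<phi> = sets X" using assms by (simp add: space_prob_algebra)
  have f: "f \<in> \<phi> \<rightarrow>\<^sub>M Y" using assms(2) measurable_cong_sets[OF s refl] by blast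
  have "distr \<phi> Z (compose (space X) g f) = distr \<phi> Z (g \<circ> f)"
    by (rule distr_cong) (auto simp: compose_def sets_eq_imp_space_eq[OF s])
  also have "\<dots> = distr (distr \<phi> Y f) Z g"
    by (rule distr_distr[symmetric]) (use assms(3) f in auto)
  finally show ?thesis .
qed

lemma distr_in_prob_algebra:
  assumes "\<phi> \<in> space (prob_algebra X)" "f \<in> X \<rightarrow>\<^sub>M Y"
  shows "distr \<phi> Y f \<in> space (prob_algebra Y)"
  using measurable_space[OF measurable_distr_prob_space[OF assms(2)] assms(1)] .

lemma giry_homD:
  assumes "f \<in> giry_hom A B"
  shows "f \<in> extensional (space (fst A))" "f \<in> fst A \<rightarrow>\<^sub>M fst B"
    "\<And>\<phi>. \<phi> \<in> space (prob_algebra (fst A)) \<Longrightarrow> f (snd A \<phi>) = snd B (distr \<phi> (fst B) f)"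
  using assms by (auto simp: giry_hom_def split: prod.splits)

lemma giry_homI:
  assumes "f \<in> extensional (space (fst A))" "f \<in> fst A \<rightarrow>\<^sub>M fst B"
    "\<And>\<phi>. \<phi> \<in> space (prob_algebra (fst A)) \<Longrightarrow> f (snd A \<phi>) = snd B (distr \<phi> (fst B) f)"
  shows "f \<in> giry_hom A B"
  using assms by (auto simp: giry_hom_def split: prod.splits)

lemma giry_algebra_measurable: "giry_algebra A \<Longrightarrow> snd A \<in> prob_algebra (fst A) \<rightarrow>\<^sub>M fst A"
  unfolding giry_algebra_def by (cases A) (simp only: prod.case fst_conv snd_conv)

lemma giry_hom_id:
  assumes "giry_algebra A"
  shows "(\<lambda>x\<in>space (fst A). x) \<in> giry_hom A A"
proof (rule giry_homI)
  have "(\<lambda>x. x) \<in> fst A \<rightarrow>\<^sub>M fst A" by (rule measurable_ident_sets) simp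
  then show "(\<lambda>x\<in>space (fst A). x) \<in> fst A \<rightarrow>\<^sub>M fst A"
    by (rule measurable_cong[THEN iffD1, rotated]) simp
  fix \<phi> assume \<phi>: "\<phi> \<in> space (prob_algebra (fst A))"
  show "(\<lambda>x\<in>space (fst A). x) (snd A \<phi>) = snd A (distr \<phi> (fst A) (\<lambda>x\<in>space (fst A). x))"
    using measurable_space[OF giry_algebra_measurable[OF assms] \<phi>]
    by (simp add: distr_restrict_id[OF \<phi>])
qed simp

lemma giry_hom_compose:
  assumes "giry_algebra A" and f: "f \<in> giry_hom A B" and g: "g \<in> giry_hom B C"
  shows "compose (space (fst A)) g f \<in> giry_hom A C"
proof (rule giry_homI)
  show "compose (space (fst A)) g f \<in> fst A \<rightarrow>\<^sub>M fst C"
    using measurable_comp[OF giry_homD(2)[OF f] giry_homD(2)[OF g]]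
    by (rule measurable_cong[THEN iffD1, rotated]) (simp add: compose_def)
  fix \<phi> assume \<phi>: "\<phi> \<in> space (prob_algebra (fst A))"
  have "snd A \<phi> \<in> space (fst A)"
    using measurable_space[OF giry_algebra_measurable[OF assms(1)] \<phi>] .
  then show "compose (space (fst A)) g f (snd A \<phi>) =
      snd C (distr \<phi> (fst C) (compose (space (fst A)) g f))"
    by (simp only: compose_apply giry_homD(3)[OF f \<phi>]
        giry_homD(3)[OF g distr_in_prob_algebra[OF \<phi> giry_homD(2)[OF f]]]
        distr_compose[OF \<phi> giry_homD(2)[OF f] giry_homD(2)[OF g]])
qed (simp add: compose_extensional)

lemma category_Giry_Alg: "category (Giry_Alg U)"
  unfolding category_def
proof (intro conjI ballI)
  fix A assume "A \<in> Obj (Giry_Alg U)"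
  then show "Idn (Giry_Alg U) A \<in> Hom (Giry_Alg U) A A"
    by (simp add: Giry_Alg_def giry_hom_id)
next
  fix A B C f g
  assume "A \<in> Obj (Giry_Alg U)" "f \<in> Hom (Giry_Alg U) A B" "g \<in> Hom (Giry_Alg U) B C"
  then show "Cmp (Giry_Alg U) A B C g f \<in> Hom (Giry_Alg U) A C"
    by (simp add: Giry_Alg_def giry_hom_compose)
next
  fix A B f assume "f \<in> Hom (Giry_Alg U) A B"
  then have f: "f \<in> giry_hom A B" by (simp add: Giry_Alg_def)
  note D = giry_homD(1)[OF f] measurable_space[OF giry_homD(2)[OF f]]
  show "Cmp (Giry_Alg U) A A B f (Idn (Giry_Alg U) A) = f"
    using D(1) by (auto simp: Giry_Alg_def compose_def extensional_def fun_eq_iff)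
  show "Cmp (Giry_Alg U) A B B (Idn (Giry_Alg U) B) f = f"
    using D by (auto simp: Giry_Alg_def compose_def extensional_def fun_eq_iff)
next
  fix A B C D f g h
  assume "f \<in> Hom (Giry_Alg U) A B"
  then have f: "f \<in> giry_hom A B" by (simp add: Giry_Alg_def)
  show "Cmp (Giry_Alg U) A C D h (Cmp (Giry_Alg U) A B C g f) =
      Cmp (Giry_Alg U) A B D (Cmp (Giry_Alg U) B C D h g) f"
    using measurable_space[OF giry_homD(2)[OF f]]
    by (auto simp: Giry_Alg_def compose_def fun_eq_iff)
qed

end

theory Submission
  imports Defs "HOL-Probability.Probability_Mass_Function"
begin

text \<open>
  An equivalence would give a Giry algebra \<open>(X, \<kappa>)\<close> whose endomorphism monoid is that of the
  convex space \<open>\<real>\<close>.  In both monoids the constant maps are exactly the elements \<open>k\<close> with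
  \<open>k \<circ> f = k\<close> for all \<open>f\<close>, so the points of \<open>X\<close> correspond to real numbers,
  with every map \<open>t \<mapsto> a t + b\<close> acting as an algebra endomorphism.  The midpoint
  \<open>\<kappa> (\<delta>\<^sub>x / 2 + \<delta>\<^sub>y / 2)\<close> commutes with these maps and is symmetric, so it must be the
  usual midpoint.  But then \<open>c = \<kappa> (\<Sum>n. 2\<^sup>-\<^sup>n\<^sup>-\<^sup>1 \<delta>\<^bsub>2^n\<^esub>)\<close> is the midpoint of \<open>1\<close> and
  \<open>2 c\<close>, that is \<open>c = 1/2 + c\<close>.
\<close>

section \<open>Equivalences are fully faithful\<close>

lemma category_comp:
  assumes "category C" "X \<in> Obj C" "Y \<in> Obj C" "Z \<in> Obj C" "f \<in> Hom C X Y" "g \<in> Hom C Y Z"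
  shows "Cmp C X Y Z g f \<in> Hom C X Z"
  using assms unfolding category_def by blast

lemma category_id:
  assumes "category C" "X \<in> Obj C" "Y \<in> Obj C" "f \<in> Hom C X Y"
  shows "Cmp C X X Y f (Idn C X) = f" "Cmp C X Y Y (Idn C Y) f = f"
  using assms unfolding category_def by blast+

lemma category_assoc:
  assumes "category C" "W \<in> Obj C" "X \<in> Obj C" "Y \<in> Obj C" "Z \<in> Obj C"
    "f \<in> Hom C W X" "g \<in> Hom C X Y" "h \<in> Hom C Y Z"
  shows "Cmp C W Y Z h (Cmp C W X Y g f) = Cmp C W X Z (Cmp C X Y Z h g) f"
  using assms unfolding category_def by blast

lemma functor_obj: "is_functor C D F \<Longrightarrow> X \<in> Obj C \<Longrightarrow> FObj F X \<in> Obj D"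
  unfolding is_functor_def by blast

lemma functor_mor:
  assumes "is_functor C D F" "X \<in> Obj C" "Y \<in> Obj C" "f \<in> Hom C X Y"
  shows "FMor F X Y f \<in> Hom D (FObj F X) (FObj F Y)"
  using assms unfolding is_functor_def by blast

lemma functor_comp:
  assumes "is_functor C D F" "X \<in> Obj C" "Y \<in> Obj C" "Z \<in> Obj C" "f \<in> Hom C X Y" "g \<in> Hom C Y Z"
  shows "FMor F X Z (Cmp C X Y Z g f) =
    Cmp D (FObj F X) (FObj F Y) (FObj F Z) (FMor F Y Z g) (FMor F X Y f)"
  using assms unfolding is_functor_def by blast

lemma naturally_isomorphic_idE:
  assumes "naturally_isomorphic C C (comp_functor G F) id_functor"
  obtains \<alpha> \<beta> where
    "\<And>X. X \<in> Obj C \<Longrightarrow> \<alpha> X \<in> Hom C (FObj G (FObj F X)) X"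
    "\<And>X. X \<in> Obj C \<Longrightarrow> \<beta> X \<in> Hom C X (FObj G (FObj F X))"
    "\<And>X. X \<in> Obj C \<Longrightarrow>
      Cmp C (FObj G (FObj F X)) X (FObj G (FObj F X)) (\<beta> X) (\<alpha> X) = Idn C (FObj G (FObj F X))"
    "\<And>X. X \<in> Obj C \<Longrightarrow> Cmp C X (FObj G (FObj F X)) X (\<alpha> X) (\<beta> X) = Idn C X"
    "\<And>X Y f. X \<in> Obj C \<Longrightarrow> Y \<in> Obj C \<Longrightarrow> f \<in> Hom C X Y \<Longrightarrow>
      Cmp C (FObj G (FObj F X)) (FObj G (FObj F Y)) Y (\<alpha> Y)
        (FMor G (FObj F X) (FObj F Y) (FMor F X Y f)) =
      Cmp C (FObj G (FObj F X)) X Y f (\<alpha> X)"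
proof -
  let ?T = "\<lambda>X. FObj G (FObj F X)"
  from assms obtain \<alpha> where iso: "\<forall>X\<in>Obj C. is_iso C (?T X) X (\<alpha> X)"
    and nat: "\<forall>X\<in>Obj C. \<forall>Y\<in>Obj C. \<forall>f\<in>Hom C X Y.
      Cmp C (?T X) (?T Y) Y (\<alpha> Y) (FMor G (FObj F X) (FObj F Y) (FMor F X Y f)) =
      Cmp C (?T X) X Y f (\<alpha> X)"
    unfolding naturally_isomorphic_def comp_functor_def id_functor_def by auto
  from iso have "\<forall>X\<in>Obj C. \<exists>g. g \<in> Hom C X (?T X) \<and>
      Cmp C (?T X) X (?T X) g (\<alpha> X) = Idn C (?T X) \<and> Cmp C X (?T X) X (\<alpha> X) g = Idn C X"
    unfolding is_iso_def by blast
  then obtain \<beta> where \<beta>: "\<forall>X\<in>Obj C. \<beta> X \<in> Hom C X (?T X) \<and>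
      Cmp C (?T X) X (?T X) (\<beta> X) (\<alpha> X) = Idn C (?T X) \<and>
      Cmp C X (?T X) X (\<alpha> X) (\<beta> X) = Idn C X"
    by metis
  show thesis
    by (rule that[of \<alpha> \<beta>]) (use iso nat \<beta> in \<open>auto simp: is_iso_def\<close>)
qed

text \<open>By naturality, \<open>F f\<close> determines the composite of \<open>f\<close> after
  \<open>\<alpha> X\<close>; precomposing with the inverse \<open>\<beta> X\<close> recovers
  \<open>f\<close>.\<close>

lemma faithful_if_left_invertible:
  assumes C: "category C" and F: "is_functor C D F" and G: "is_functor D C G"
    and n: "naturally_isomorphic C C (comp_functor G F) id_functor"
    and X: "X \<in> Obj C" and Y: "Y \<in> Obj C"
  shows "inj_on (FMor F X Y) (Hom C X Y)"
proof (rule inj_onI)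
  obtain \<alpha> \<beta> where a: "\<And>X. X \<in> Obj C \<Longrightarrow> \<alpha> X \<in> Hom C (FObj G (FObj F X)) X"
    and b: "\<And>X. X \<in> Obj C \<Longrightarrow> \<beta> X \<in> Hom C X (FObj G (FObj F X))"
    and ab: "\<And>X. X \<in> Obj C \<Longrightarrow> Cmp C X (FObj G (FObj F X)) X (\<alpha> X) (\<beta> X) = Idn C X"
    and nat: "\<And>X Y f. X \<in> Obj C \<Longrightarrow> Y \<in> Obj C \<Longrightarrow> f \<in> Hom C X Y \<Longrightarrow>
      Cmp C (FObj G (FObj F X)) (FObj G (FObj F Y)) Y (\<alpha> Y)
        (FMor G (FObj F X) (FObj F Y) (FMor F X Y f)) =
      Cmp C (FObj G (FObj F X)) X Y f (\<alpha> X)"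
    using naturally_isomorphic_idE[OF n] by metis
  let ?T = "FObj G (FObj F X)"
  have T: "?T \<in> Obj C" using functor_obj[OF G functor_obj[OF F X]] .
  have recover: "Cmp C X ?T Y (Cmp C ?T X Y f (\<alpha> X)) (\<beta> X) = f" if "f \<in> Hom C X Y" for f
    using category_assoc[OF C X T X Y b[OF X] a[OF X] that] category_id(1)[OF C X Y that]
    by (simp add: ab[OF X])
  fix f g assume f: "f \<in> Hom C X Y" and g: "g \<in> Hom C X Y" and "FMor F X Y f = FMor F X Y g"
  then have "Cmp C ?T X Y f (\<alpha> X) = Cmp C ?T X Y g (\<alpha> X)"
    using nat[OF X Y f] nat[OF X Y g] by simp
  then show "f = g" using recover[OF f] recover[OF g] by metis
qed

text \<open>Fullness of \<open>G\<close> rests on faithfulness of \<open>F\<close>: a morphism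
  \<open>f\<close> with \<open>F (G f) = F h\<close> is constructed, and then
  \<open>G f = h\<close>.\<close>

lemma full_if_equivalence:
  assumes C: "category C" and D: "category D"
    and F: "is_functor C D F" and G: "is_functor D C G"
    and n: "naturally_isomorphic C C (comp_functor G F) id_functor"
    and n': "naturally_isomorphic D D (comp_functor F G) id_functor"
    and R: "R \<in> Obj D" and S: "S \<in> Obj D"
  shows "FMor G R S ` Hom D R S = Hom C (FObj G R) (FObj G S)"
proof (rule antisym)
  show "FMor G R S ` Hom D R S \<subseteq> Hom C (FObj G R) (FObj G S)"
    using functor_mor[OF G R S] by blast
next
  obtain \<alpha> \<beta> where a: "\<And>X. X \<in> Obj D \<Longrightarrow> \<alpha> X \<in> Hom D (FObj F (FObj G X)) X"
    and b: "\<And>X. X \<in> Obj D \<Longrightarrow> \<beta> X \<in> Hom D X (FObj F (FObj G X))"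
    and ba: "\<And>X. X \<in> Obj D \<Longrightarrow>
      Cmp D (FObj F (FObj G X)) X (FObj F (FObj G X)) (\<beta> X) (\<alpha> X) = Idn D (FObj F (FObj G X))"
    and nat: "\<And>X Y f. X \<in> Obj D \<Longrightarrow> Y \<in> Obj D \<Longrightarrow> f \<in> Hom D X Y \<Longrightarrow>
      Cmp D (FObj F (FObj G X)) (FObj F (FObj G Y)) Y (\<alpha> Y)
        (FMor F (FObj G X) (FObj G Y) (FMor G X Y f)) =
      Cmp D (FObj F (FObj G X)) X Y f (\<alpha> X)"
    using naturally_isomorphic_idE[OF n'] by metis
  note GR = functor_obj[OF G R] and GS = functor_obj[OF G S]
  let ?R = "FObj F (FObj G R)" and ?S = "FObj F (FObj G S)"
  have R': "?R \<in> Obj D" and S': "?S \<in> Obj D"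
    using functor_obj[OF F GR] functor_obj[OF F GS] .
  have cancel: "Cmp D ?R S ?S (\<beta> S) (Cmp D ?R ?S S (\<alpha> S) k) = k" if "k \<in> Hom D ?R ?S" for k
    using category_assoc[OF D R' S' S S' that a[OF S] b[OF S]] category_id(2)[OF D R' S' that]
    by (simp add: ba[OF S])
  show "Hom C (FObj G R) (FObj G S) \<subseteq> FMor G R S ` Hom D R S"
  proof
    fix h assume h: "h \<in> Hom C (FObj G R) (FObj G S)"
    let ?h = "FMor F (FObj G R) (FObj G S) h"
    let ?k = "Cmp D ?R ?S S (\<alpha> S) ?h"
    have h': "?h \<in> Hom D ?R ?S" using functor_mor[OF F GR GS h] .
    have k: "?k \<in> Hom D ?R S" using category_comp[OF D R' S' S h' a[OF S]] .
    \<comment> \<open>Naturality asks that \<open>f\<close> after \<open>\<alpha> R\<close> equal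
      \<open>\<alpha> S\<close> after \<open>F h\<close>. Solving for \<open>f\<close> gives
      \<open>F h\<close> conjugated by the isomorphisms.\<close>
    define f where "f = Cmp D R ?R S ?k (\<beta> R)"
    have f: "f \<in> Hom D R S" unfolding f_def using category_comp[OF D R R' S b[OF R] k] .
    have "Cmp D ?R R S f (\<alpha> R) = ?k"
      unfolding f_def using category_assoc[OF D R' R R' S a[OF R] b[OF R] k]
        category_id(1)[OF D R' S k] by (simp add: ba[OF R])
    then have "Cmp D ?R ?S S (\<alpha> S) (FMor F (FObj G R) (FObj G S) (FMor G R S f)) = ?k"
      using nat[OF R S f] by simp
    then have "FMor F (FObj G R) (FObj G S) (FMor G R S f) = ?h"
      using cancel[OF h'] cancel[OF functor_mor[OF F GR GS functor_mor[OF G R S f]]] by simp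
    then have "FMor G R S f = h"
      using faithful_if_left_invertible[OF C F G n GR GS] functor_mor[OF G R S f] h
      by (auto dest: inj_onD)
    then show "h \<in> FMor G R S ` Hom D R S" using f by blast
  qed
qed

text \<open>This is the only consequence of the equivalence used below. A multiplicative bijection
  is enough, since constant maps will be recognised by composition alone.\<close>

lemma equivalent_categories_endomorphisms:
  assumes C: "category C" and D: "category D" and "equivalent_categories C D" and R: "R \<in> Obj D"
  obtains X \<Phi> where "X \<in> Obj C" "bij_betw \<Phi> (Hom D R R) (Hom C X X)"
    "\<And>f g. f \<in> Hom D R R \<Longrightarrow> g \<in> Hom D R R \<Longrightarrow> \<Phi> (Cmp D R R R g f) = Cmp C X X X (\<Phi> g) (\<Phi> f)"
proof -
  from assms(3) obtain F G where F: "is_functor C D F" and G: "is_functor D C G"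
    and n: "naturally_isomorphic C C (comp_functor G F) id_functor"
    and n': "naturally_isomorphic D D (comp_functor F G) id_functor"
    unfolding equivalent_categories_def by blast
  show thesis
  proof (rule that[of "FObj G R" "FMor G R R"])
    show "FObj G R \<in> Obj C" using functor_obj[OF G R] .
    show "bij_betw (FMor G R R) (Hom D R R) (Hom C (FObj G R) (FObj G R))"
      unfolding bij_betw_def
      using faithful_if_left_invertible[OF D G F n' R R] full_if_equivalence[OF C D F G n n' R R]
      by blast
  qed (rule functor_comp[OF G R R R])
qed

section \<open>Discrete distributions on a Giry algebra\<close>

text \<open>A pmf lives on a discrete space, so every \<open>y\<close> with values in
  \<open>X\<close> is measurable. The pushforward is a countable convex combination of the Dirac
  measures at the points \<open>y b\<close>.\<close>

lemma distr_pmf_in_prob_algebra: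
  assumes "\<And>b. y b \<in> space X"
  shows "distr (measure_pmf q) X y \<in> space (prob_algebra X)"
  unfolding space_prob_algebra using assms
  by (auto intro!: prob_space.prob_space_distr measure_pmf.prob_space_axioms)

text \<open>Both sides give \<open>K\<close> the \<open>q\<close>-average of the probabilities that
  \<open>y\<close> lies in \<open>K\<close> under \<open>r c\<close>.\<close>

lemma giry_mult_distr_pmf:
  assumes y: "\<And>b. y b \<in> space X"
  shows "giry_mult (distr (measure_pmf q) (prob_algebra X) (\<lambda>c. distr (measure_pmf (r c)) X y)) =
    distr (measure_pmf (bind_pmf q r)) X y"
proof (rule measure_eqI)
  let ?\<Phi> = "distr (measure_pmf q) (prob_algebra X) (\<lambda>c. distr (measure_pmf (r c)) X y)"
  have \<Phi>: "?\<Phi> \<in> space (prob_algebra (prob_algebra X))"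
    by (rule distr_pmf_in_prob_algebra) (rule distr_pmf_in_prob_algebra[OF y])
  have s: "sets (giry_mult ?\<Phi>) = sets X"
    using giry_mult_in_prob_algebra[OF \<Phi>] by (simp add: space_prob_algebra)
  then show "sets (giry_mult ?\<Phi>) = sets (distr (measure_pmf (bind_pmf q r)) X y)" by simp
  fix K assume "K \<in> sets (giry_mult ?\<Phi>)"
  then have K: "K \<in> sets X" using s by simp
  have "emeasure (giry_mult ?\<Phi>) K = (\<integral>\<^sup>+\<xi>. emeasure \<xi> K \<partial>?\<Phi>)"
    by (rule emeasure_giry_mult[OF \<Phi> K])
  also have "\<dots> = (\<integral>\<^sup>+c. emeasure (distr (measure_pmf (r c)) X y) K \<partial>measure_pmf q)"
  proof (rule nn_integral_distr)
    have "(\<lambda>\<xi>. emeasure \<xi> K) \<in> borel_measurable (prob_algebra X)"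
      unfolding prob_algebra_def
      by (intro measurable_restrict_space1 measurable_emeasure_subprob_algebra K)
    then show "(\<lambda>\<xi>. emeasure \<xi> K) \<in> borel_measurable ?\<Phi>" by simp
  qed (use y in \<open>auto intro!: distr_pmf_in_prob_algebra\<close>)
  also have "\<dots> = emeasure (distr (measure_pmf (bind_pmf q r)) X y) K"
    using K y by (simp add: emeasure_distr emeasure_bind_pmf)
  finally show "emeasure (giry_mult ?\<Phi>) K = \<dots>" .
qed

text \<open>The associativity law of the algebra, read for discrete laws: a barycentre of
  barycentres is the barycentre of the compound law.\<close>

lemma giry_algebra_pmf_bind:
  assumes A: "giry_algebra A" and y: "\<And>b. y b \<in> space (fst A)"
  shows "snd A (distr (measure_pmf q) (fst A) (\<lambda>c. snd A (distr (measure_pmf (r c)) (fst A) y))) =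
    snd A (distr (measure_pmf (bind_pmf q r)) (fst A) y)"
proof -
  obtain X \<kappa> where [simp]: "A = (X, \<kappa>)" by (cases A)
  let ?\<mu> = "\<lambda>c. distr (measure_pmf (r c)) X y"
  let ?\<Phi> = "distr (measure_pmf q) (prob_algebra X) ?\<mu>"
  have \<mu>: "?\<mu> c \<in> space (prob_algebra X)" for c
    by (rule distr_pmf_in_prob_algebra) (use y in simp)
  have \<kappa>: "\<kappa> \<in> prob_algebra X \<rightarrow>\<^sub>M X" using giry_algebra_measurable[OF A] by simp
  have "?\<Phi> \<in> space (prob_algebra (prob_algebra X))"
    by (rule distr_pmf_in_prob_algebra) (rule \<mu>)
  then have "\<kappa> (distr ?\<Phi> X \<kappa>) = \<kappa> (giry_mult ?\<Phi>)"
    using A by (auto simp: giry_algebra_def)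
  moreover have "distr ?\<Phi> X \<kappa> = distr (measure_pmf q) X (\<lambda>c. \<kappa> (?\<mu> c))"
    by (subst distr_distr[OF \<kappa>]) (use \<mu> in \<open>auto simp: comp_def\<close>)
  moreover have "giry_mult ?\<Phi> = distr (measure_pmf (bind_pmf q r)) X y"
    by (rule giry_mult_distr_pmf) (use y in simp)
  ultimately show ?thesis by simp
qed

lemma giry_hom_pmf:
  assumes h: "h \<in> giry_hom A B" and y: "\<And>b. y b \<in> space (fst A)"
  shows "h (snd A (distr (measure_pmf q) (fst A) y)) =
    snd B (distr (measure_pmf q) (fst B) (\<lambda>b. h (y b)))"
proof -
  have "distr (distr (measure_pmf q) (fst A) y) (fst B) h =
      distr (measure_pmf q) (fst B) (\<lambda>b. h (y b))"
    by (subst distr_distr[OF giry_homD(2)[OF h]]) (use y in \<open>auto simp: comp_def\<close>)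
  then show ?thesis
    using giry_homD(3)[OF h distr_pmf_in_prob_algebra[where y = y and q = q, OF y]] by simp
qed

lemma distr_map_pmf_eq:
  assumes "\<And>b. y b \<in> space X"
  shows "distr (measure_pmf (map_pmf g q)) X y = distr (measure_pmf q) X (\<lambda>b. y (g b))"
  unfolding map_pmf_rep_eq by (subst distr_distr) (use assms in \<open>auto simp: comp_def\<close>)

text \<open>Pushing forward along a constant map yields a Dirac measure, which the unit law sends
  back to its point.\<close>

lemma giry_hom_const:
  assumes A: "giry_algebra A" and B: "giry_algebra B" and p: "p \<in> space (fst B)"
  shows "(\<lambda>x\<in>space (fst A). p) \<in> giry_hom A B"
proof (rule giry_homI)
  let ?k = "\<lambda>x\<in>space (fst A). p"
  show "?k \<in> fst A \<rightarrow>\<^sub>M fst B"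
    using measurable_const[OF p] by (rule measurable_cong[THEN iffD1, rotated]) simp
  fix \<phi> assume \<phi>: "\<phi> \<in> space (prob_algebra (fst A))"
  then have s: "sets \<phi> = sets (fst A)" and pr: "prob_space \<phi>" by (auto simp: space_prob_algebra)
  have "distr \<phi> (fst B) ?k = distr \<phi> (fst B) (\<lambda>_. p)"
    by (rule distr_cong) (auto simp: sets_eq_imp_space_eq[OF s])
  also have "\<dots> = return (fst B) p" using prob_space.distr_const[OF pr p] .
  moreover have "snd B (return (fst B) p) = p"
    using B p by (auto simp: giry_algebra_def split: prod.splits)
  ultimately show "?k (snd A \<phi>) = snd B (distr \<phi> (fst B) ?k)"
    using measurable_space[OF giry_algebra_measurable[OF A] \<phi>] by simp
qed simp

text \<open>Midpoints are forced to be Euclidean, yet the structure map must also give a barycentre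
  to a discrete law with infinite mean.\<close>

lemma no_giry_algebra_on_affine_line:
  assumes A: "giry_algebra A" and P: "bij_betw P (UNIV :: real set) (space (fst A))"
    and h: "\<And>a b. h a b \<in> giry_hom A A"
    and hP: "\<And>a b t. h a b (P t) = P (a * t + b)"
  shows False
proof -
  \<comment> \<open>\<open>K\<close> and \<open>L\<close> are the same barycentre map; two copies
    are needed because a local definition has one fixed index type.\<close>
  define K :: "bool pmf \<Rightarrow> (bool \<Rightarrow> 'a) \<Rightarrow> 'a"
    where "K q y = snd A (distr (measure_pmf q) (fst A) y)" for q y
  define L :: "nat pmf \<Rightarrow> (nat \<Rightarrow> 'a) \<Rightarrow> 'a"
    where "L q y = snd A (distr (measure_pmf q) (fst A) y)" for q y
  have PX [simp]: "P t \<in> space (fst A)" for t using P by (auto simp: bij_betw_def)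
  have P_inj: "P s = P t \<longleftrightarrow> s = t" for s t using P by (auto simp: bij_betw_def inj_on_def)
  have surj: "\<exists>t. x = P t" if "x \<in> space (fst A)" for x
    using P that by (auto simp: bij_betw_def)
  have in_X: "snd A (distr (measure_pmf q) (fst A) y) \<in> space (fst A)"
    if "\<And>b. y b \<in> space (fst A)" for q :: "'b pmf" and y
    using measurable_space[OF giry_algebra_measurable[OF A] distr_pmf_in_prob_algebra[where y = y and q = q, OF that]] .
  let ?B = "bernoulli_pmf (1/2)"
  define m where "m s t = K ?B (\<lambda>b. if b then P s else P t)" for s t
  have hm: "h a b (m s t) = m (a * s + b) (a * t + b)" for a b s t
    unfolding m_def K_def
    by (subst giry_hom_pmf[OF h]) (auto simp: if_distrib[of "h a b"] hP cong: if_cong)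
  have m_sym: "m s t = m t s" for s t
  proof -
    \<comment> \<open>Negation preserves the fair coin, so reindexing by it exchanges the two
      points.\<close>
    have "pmf (map_pmf Not ?B) b = pmf ?B b" for b
      using pmf_map_inj'[of Not ?B "\<not> b"] by (cases b) (simp_all add: inj_def)
    then have "map_pmf Not ?B = ?B" by (rule pmf_eqI)
    then have "m s t = K (map_pmf Not ?B) (\<lambda>b. if b then P s else P t)" by (simp add: m_def)
    also have "\<dots> = K ?B (\<lambda>b. if \<not> b then P s else P t)"
      unfolding K_def by (subst distr_map_pmf_eq) simp_all
    also have "(\<lambda>b. if \<not> b then P s else P t) = (\<lambda>b. if b then P t else P s)" by auto
    finally show ?thesis by (simp add: m_def)
  qed
  have "m 0 1 \<in> space (fst A)" unfolding m_def K_def by (rule in_X) simp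
  then obtain w where w: "m 0 1 = P w" using surj by blast
  \<comment> \<open>The reflection \<open>h (-1) 1\<close> swaps \<open>P 0\<close> and
    \<open>P 1\<close>, hence fixes their midpoint.\<close>
  have "P (1 - w) = h (-1) 1 (m 0 1)" by (simp add: w hP)
  also have "\<dots> = m 0 1" by (subst hm) (simp add: m_sym)
  finally have w_half: "w = 1/2" by (simp add: w P_inj)
  have mid: "m s t = P ((s + t) / 2)" for s t
  proof -
    \<comment> \<open>The affine map with slope \<open>t - s\<close> and intercept \<open>s\<close>
      carries 0 and 1 to \<open>s\<close> and \<open>t\<close>.\<close>
    have "m s t = h (t - s) s (m 0 1)" by (subst hm) simp
    then show ?thesis by (simp add: w hP w_half field_simps)
  qed
  \<comment> \<open>Counting starts at 0, so the point \<open>2 ^ n\<close> has weight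
    \<open>1 / 2 ^ (n + 1)\<close>; each term adds 1/2 to the mean, which diverges.\<close>
  let ?G = "geometric_pmf (1/2)" and ?y = "\<lambda>n::nat. P (2 ^ n)"
  have "L ?G ?y \<in> space (fst A)" unfolding L_def by (rule in_X) simp
  then obtain t where t: "L ?G ?y = P t" using surj by blast
  have shift: "L (map_pmf Suc ?G) ?y = P (2 * t)"
  proof -
    \<comment> \<open>Raising the exponent by one is doubling, so the shift of the index becomes the
      endomorphism \<open>h 2 0\<close>.\<close>
    have "L (map_pmf Suc ?G) ?y = L ?G (\<lambda>n. h 2 0 (?y n))"
      unfolding L_def by (subst distr_map_pmf_eq) (simp_all add: hP)
    also have "\<dots> = h 2 0 (L ?G ?y)"
      unfolding L_def by (rule giry_hom_pmf[OF h, symmetric]) simp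
    finally show ?thesis by (simp add: t hP)
  qed
  \<comment> \<open>Condition on the first toss: success stops at 0, failure restarts the count one
    higher.\<close>
  have unfold: "?G = bind_pmf ?B (\<lambda>b. if b then return_pmf 0 else map_pmf Suc ?G)"
    using geometric_bind_pmf_unfold[of "1/2"] by simp
  have zero: "L (return_pmf 0) ?y = P 1"
  proof -
    \<comment> \<open>The point mass is the image of the coin under a constant map, so it becomes
      the midpoint of \<open>P 1\<close> with itself.\<close>
    have "L (return_pmf 0) ?y = K ?B (\<lambda>b. P 1)"
      unfolding L_def K_def
      using distr_map_pmf_eq[of ?y "fst A" "\<lambda>_. 0" ?B] by (simp add: map_pmf_const)
    also have "\<dots> = m 1 1" by (simp add: m_def)
    finally show ?thesis by (simp add: mid)
  qed
  have "P t = L (bind_pmf ?B (\<lambda>b. if b then return_pmf 0 else map_pmf Suc ?G)) ?y"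
    using t by (simp only: unfold[symmetric])
  also have "\<dots> = K ?B (\<lambda>b. L (if b then return_pmf 0 else map_pmf Suc ?G) ?y)"
    unfolding L_def K_def by (rule giry_algebra_pmf_bind[OF A, symmetric]) simp
  also have "(\<lambda>b. L (if b then return_pmf 0 else map_pmf Suc ?G) ?y) =
      (\<lambda>b. if b then P 1 else P (2 * t))"
    by (auto simp: zero shift)
  also have "K ?B \<dots> = P ((1 + 2 * t) / 2)" using mid[of 1 "2 * t"] by (simp add: m_def)
  finally show False by (simp add: P_inj)
qed

section \<open>The real line as a convex space\<close>

text \<open>The real line transported along \<open>e\<close> so that its carrier lies in the
  universe. The weight \<open>r\<close> sits on the second argument, as \<open>x +_0 y = x\<close>
  demands.\<close>

definition line :: "(real \<Rightarrow> 'a) \<Rightarrow> 'a set \<times> (real \<Rightarrow> 'a \<Rightarrow> 'a \<Rightarrow> 'a)" where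
  "line e = (range e, \<lambda>r x y. if r \<in> {0..1} \<and> x \<in> range e \<and> y \<in> range e
     then e ((1 - r) * inv e x + r * inv e y) else undefined)"

definition line_map :: "(real \<Rightarrow> 'a) \<Rightarrow> real \<Rightarrow> real \<Rightarrow> 'a \<Rightarrow> 'a" where
  "line_map e a b = (\<lambda>x\<in>range e. e (a * inv e x + b))"

lemma convex_space_line:
  assumes "inj e"
  shows "convex_space (line e)"
proof -
  have assoc: "(1 - s) * ((1 - r) * x + r * y) + s * z =
      (1 - t) * x + t * ((1 - s / t) * y + s / t * z)"
    and quotient: "s / t \<le> 1" and t: "0 \<le> t" "t \<le> 1"
    if "0 \<le> r" "r \<le> 1" "0 < s" "s \<le> 1" "t = r + s - r * s" for r s t x y z :: real
  proof -
    \<comment> \<open>These products are \<open>t - s\<close> and \<open>1 - t\<close>.\<close>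
    have "0 \<le> r * (1 - s)" "0 \<le> (1 - r) * (1 - s)" using that by auto
    then have st: "s \<le> t" and t1: "t \<le> 1" unfolding that(5) by (simp_all add: algebra_simps)
    with that(3) have "t > 0" by linarith
    then show "s / t \<le> 1" "0 \<le> t" "t \<le> 1" using st t1 by simp_all
    have "t * ((1 - s / t) * y + s / t * z) = (t - s) * y + s * z"
      using \<open>t > 0\<close> by (simp add: field_simps)
    then show "(1 - s) * ((1 - r) * x + r * y) + s * z =
        (1 - t) * x + t * ((1 - s / t) * y + s / t * z)"
      unfolding that(5) by (simp add: algebra_simps)
  qed
  show ?thesis
    unfolding convex_space_def line_def prod.case Let_def
  proof (intro conjI ballI, goal_cases)
    \<comment> \<open>Associativity. The bounds on \<open>t\<close> and \<open>s / t\<close> keep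
      both parameters in the unit interval, outside which the operation is
      \<open>undefined\<close>.\<close>
    case (6 r s x y z)
    then obtain a b c where [simp]: "x = e a" "y = e b" "z = e c" by blast
    define t where "t = r + s - r * s"
    have *: "0 \<le> r" "r \<le> 1" "0 < s" "s \<le> 1" using 6 by auto
    show ?case
      unfolding t_def[symmetric]
      using * quotient[OF * t_def] t[OF * t_def] assoc[OF * t_def, of a b c]
      by (simp add: assms)
  qed (use assms in \<open>auto simp: algebra_simps\<close>)
qed

lemma line_map_apply: "inj e \<Longrightarrow> line_map e a b (e t) = e (a * t + b)"
  by (simp add: line_map_def)

lemma line_map_in_affine_hom:
  assumes "inj e"
  shows "line_map e a b \<in> affine_hom (line e) (line e)"
proof (rule affine_homI)
  show "line_map e a b \<in> extensional (fst (line e))" by (simp add: line_def line_map_def)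
  show "line_map e a b x \<in> fst (line e)" if "x \<in> fst (line e)" for x
    using that by (auto simp: line_def line_map_def)
  show "line_map e a b (snd (line e) r x y) =
      snd (line e) r (line_map e a b x) (line_map e a b y)"
    if r: "r \<in> {0..1}" and xy: "x \<in> fst (line e)" "y \<in> fst (line e)" for r x y
  proof -
    obtain s t where [simp]: "x = e s" "y = e t" using xy by (simp add: line_def) blast
    show ?thesis using r assms
      by (simp add: line_def line_map_apply) (simp add: algebra_simps)
  qed
qed

lemma compose_line_map:
  assumes "inj e"
  shows "compose (range e) (line_map e a b) (line_map e c d) = line_map e (a * c) (a * d + b)"
  using assms by (auto simp: compose_def line_map_def fun_eq_iff algebra_simps)

lemma line_map_eqD:
  assumes "inj e" "line_map e a b = line_map e c d"
  shows "b = d"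
  using line_map_apply[OF assms(1), of a b 0] line_map_apply[OF assms(1), of c d 0] assms
  by (simp add: inj_eq)

section \<open>Transport of the real affine maps to a Giry algebra\<close>

theorem mainTheorem3:
  fixes U :: "'a set set"
  assumes "carrier_universe U"
  shows "\<not> equivalent_categories (Giry_Alg U) (Cvx U)"
proof
  assume eq: "equivalent_categories (Giry_Alg U) (Cvx U)"
  from assms obtain e :: "real \<Rightarrow> 'a" where e: "inj e" and U: "range e \<in> U"
    unfolding carrier_universe_def by blast
  let ?E = "affine_hom (line e) (line e)"
  have fst_line [simp]: "fst (line e) = range e" by (simp add: line_def)
  have "line e \<in> Obj (Cvx U)" using convex_space_line[OF e] U by (simp add: Cvx_def)
  from equivalent_categories_endomorphisms[OF category_Giry_Alg category_Cvx eq this]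
  obtain A \<Phi> where "A \<in> Obj (Giry_Alg U)"
    and "bij_betw \<Phi> (Hom (Cvx U) (line e) (line e)) (Hom (Giry_Alg U) A A)"
    and "\<And>f g. f \<in> Hom (Cvx U) (line e) (line e) \<Longrightarrow> g \<in> Hom (Cvx U) (line e) (line e) \<Longrightarrow>
      \<Phi> (Cmp (Cvx U) (line e) (line e) (line e) g f) = Cmp (Giry_Alg U) A A A (\<Phi> g) (\<Phi> f)"
    by blast
  then have A: "giry_algebra A" and bij: "bij_betw \<Phi> ?E (giry_hom A A)"
    and comp: "\<And>f g. f \<in> ?E \<Longrightarrow> g \<in> ?E \<Longrightarrow>
      \<Phi> (compose (range e) g f) = compose (space (fst A)) (\<Phi> g) (\<Phi> f)"
    by (simp_all add: Giry_Alg_def Cvx_def)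
  let ?X = "space (fst A)"
  let ?l = "line_map e"
  note lE = line_map_in_affine_hom[OF e]
  have \<Phi>_hom: "\<Phi> f \<in> giry_hom A A" if "f \<in> ?E" for f using bij that by (auto simp: bij_betw_def)
  have \<Phi>_inj: "f = g" if "\<Phi> f = \<Phi> g" "f \<in> ?E" "g \<in> ?E" for f g
    using bij that by (auto simp: bij_betw_def dest: inj_onD)
  have \<Phi>_space: "\<Phi> f x \<in> ?X" if "f \<in> ?E" "x \<in> ?X" for f x
    using measurable_space[OF giry_homD(2)[OF \<Phi>_hom[OF that(1)]] that(2)] .
  have ext: "\<Phi> f \<in> extensional ?X" if "f \<in> ?E" for f using giry_homD(1)[OF \<Phi>_hom[OF that]] .
  have "?X \<noteq> {}"
  proof
    assume "?X = {}"
    \<comment> \<open>Only one extensional function exists on an empty domain, so two different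
      constants would have the same image.\<close>
    then have "\<Phi> (?l 0 0) = \<Phi> (?l 0 1)" using ext[OF lE, of 0 0] ext[OF lE, of 0 1] by simp
    from line_map_eqD[OF e \<Phi>_inj[OF this lE lE]] show False by simp
  qed
  then obtain x0 where x0: "x0 \<in> ?X" by blast
  have const_full: "\<exists>f\<in>?E. \<Phi> f = (\<lambda>x\<in>?X. p)" if "p \<in> ?X" for p
  proof -
    have "(\<lambda>x\<in>?X. p) \<in> \<Phi> ` ?E"
      using bij giry_hom_const[OF A A that] by (simp add: bij_betw_def)
    then show ?thesis by (rule imageE) auto
  qed
  have \<Phi>_const: "\<Phi> (?l 0 t) x = \<Phi> (?l 0 t) x0" if x: "x \<in> ?X" for t x
  proof -
    \<comment> \<open>Let \<open>f\<close> correspond to the constant map at \<open>x0\<close>. The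
      constant \<open>?l 0 t\<close> absorbs \<open>f\<close> on the right; applying
      \<open>\<Phi>\<close> to this identity moves every \<open>x\<close> to
      \<open>x0\<close>.\<close>
    obtain f where f: "f \<in> ?E" "\<Phi> f = (\<lambda>x\<in>?X. x0)" using const_full[OF x0] by blast
    have "compose (range e) (?l 0 t) f = ?l 0 t"
      using affine_homD(2)[OF f(1)] by (auto simp: compose_def line_map_def fun_eq_iff)
    then have "\<Phi> (?l 0 t) = compose ?X (\<Phi> (?l 0 t)) (\<Phi> f)" using comp[OF f(1) lE] by metis
    then have "\<Phi> (?l 0 t) x = compose ?X (\<Phi> (?l 0 t)) (\<Phi> f) x" by metis
    then show ?thesis using x by (simp add: compose_def f(2))
  qed
  define P where "P t = \<Phi> (?l 0 t) x0" for t
  have P_const: "\<Phi> (?l 0 t) = (\<lambda>x\<in>?X. P t)" for t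
    using ext[OF lE, of 0 t] \<Phi>_const unfolding P_def
    by (auto simp: fun_eq_iff extensional_def restrict_def)
  have "bij_betw P UNIV ?X"
    unfolding bij_betw_def
  proof
    show "inj P"
    proof (rule injI)
      fix s t assume "P s = P t"
      then have "\<Phi> (?l 0 s) = \<Phi> (?l 0 t)" by (simp add: P_const)
      from line_map_eqD[OF e \<Phi>_inj[OF this lE lE]] show "s = t" .
    qed
    have "p \<in> range P" if p: "p \<in> ?X" for p
    proof -
      obtain f where f: "f \<in> ?E" "\<Phi> f = (\<lambda>x\<in>?X. p)" using const_full[OF p] by blast
      \<comment> \<open>The converse absorption: \<open>\<Phi> f\<close> is constant, so it absorbs
        the image of \<open>?l 0 0\<close>. By injectivity \<open>f\<close> factors through a
        constant map and is itself constant.\<close>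
      have "\<Phi> (compose (range e) f (?l 0 0)) = \<Phi> f"
        using comp[OF lE f(1), of 0 0] \<Phi>_space[OF lE]
        by (auto simp: f(2) compose_def fun_eq_iff)
      moreover have "compose (range e) f (?l 0 0) \<in> ?E"
        using affine_hom_compose[OF convex_space_line[OF e] lE f(1)] by simp
      ultimately have f0: "f = compose (range e) f (?l 0 0)" using \<Phi>_inj f(1) by metis
      obtain t where t: "f (e 0) = e t" using affine_homD(2)[OF f(1), of "e 0"] by auto
      have "f = ?l 0 t" by (subst f0) (auto simp: compose_def line_map_def fun_eq_iff t e)
      then have "p = P t" using f(2) x0 by (simp add: P_def)
      then show ?thesis by blast
    qed
    moreover have "P t \<in> ?X" for t unfolding P_def by (rule \<Phi>_space[OF lE x0])
    ultimately show "range P = ?X" by blast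
  qed
  moreover have "\<Phi> (?l a b) (P t) = P (a * t + b)" for a b t
  proof -
    \<comment> \<open>An affine map after the constant \<open>t\<close> is the constant
      \<open>a * t + b\<close>; evaluating the images at \<open>x0\<close> gives the action on
      \<open>P t\<close>.\<close>
    have "\<Phi> (?l 0 (a * t + b)) = compose ?X (\<Phi> (?l a b)) (\<Phi> (?l 0 t))"
      using comp[OF lE lE, of a b 0 t] by (simp add: compose_line_map[OF e])
    then have "P (a * t + b) = compose ?X (\<Phi> (?l a b)) (\<Phi> (?l 0 t)) x0" by (simp add: P_def)
    then show ?thesis using x0 by (simp add: compose_def P_def)
  qed
  ultimately show False
    using no_giry_algebra_on_affine_line[OF A, of P "\<lambda>a b. \<Phi> (?l a b)"] \<Phi>_hom[OF lE] by blast
qed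

end
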